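(* Let $T$ be a tree. Then either $T$ is a path or ${\rm I}_e(T)\le\frac{1}{3}|E(T)|$.
   Context: All graphs are finite and simple. A graph is locally irregular if no two adjacent vertices have the same degree. An edge-irregulator of a graph $G$ is a set $S\subseteq E(G)$ such that $G-S$ is locally irregular; ${\rm I}_e(G)$ is the minimum cardinality of an edge-irregulator of $G$. *)

theory Defs
  imports Main
begin

(* A finite simple graph: vertex set V, edge set E of 2-element subsets of V. *)
definition simple_graph :: "'a set \<Rightarrow> 'a set set \<Rightarrow> bool" where
  "simple_graph V E \<longleftrightarrow> finite V \<and> (\<forall>e\<in>E. \<exists>u v. u \<noteq> v \<and> u \<in> V \<and> v \<in> V \<and> e = {u, v})"

definition adj :: "'a set set \<Rightarrow> 'a \<Rightarrow> 'a \<Rightarrow> bool" where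
  "adj E u v \<longleftrightarrow> u \<noteq> v \<and> {u, v} \<in> E"

definition degree :: "'a set set \<Rightarrow> 'a \<Rightarrow> nat" where
  "degree E v = card {e \<in> E. v \<in> e}"

definition locally_irregular :: "'a set set \<Rightarrow> bool" where
  "locally_irregular E \<longleftrightarrow> (\<forall>u v. adj E u v \<longrightarrow> degree E u \<noteq> degree E v)"

definition edge_irregulator :: "'a set set \<Rightarrow> 'a set set \<Rightarrow> bool" where
  "edge_irregulator E S \<longleftrightarrow> S \<subseteq> E \<and> locally_irregular (E - S)"

definition Ie :: "'a set set \<Rightarrow> nat" where
  "Ie E = (LEAST k. \<exists>S. edge_irregulator E S \<and> card S = k)"

definition connected_graph :: "'a set \<Rightarrow> 'a set set \<Rightarrow> bool" where
  "connected_graph V E \<longleftrightarrow> (\<forall>u\<in>V. \<forall>v\<in>V. (u, v) \<in> {(x, y). adj E x y}\<^sup>*)"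

(* a cycle: a list of k \<ge> 3 distinct vertices, consecutive ones adjacent, last adjacent to first *)
definition has_cycle :: "'a set set \<Rightarrow> bool" where
  "has_cycle E \<longleftrightarrow> (\<exists>xs. length xs \<ge> 3 \<and> distinct xs \<and>
      (\<forall>i. Suc i < length xs \<longrightarrow> adj E (xs ! i) (xs ! Suc i)) \<and> adj E (last xs) (hd xs))"

definition tree :: "'a set \<Rightarrow> 'a set set \<Rightarrow> bool" where
  "tree V E \<longleftrightarrow> simple_graph V E \<and> V \<noteq> {} \<and> connected_graph V E \<and> \<not> has_cycle E"

(* G is a path graph P_n: its vertices can be listed without repetition so that the edges are
   exactly the consecutive pairs *)
definition is_path_graph :: "'a set \<Rightarrow> 'a set set \<Rightarrow> bool" where
  "is_path_graph V E \<longleftrightarrow> (\<exists>xs. xs \<noteq> [] \<and> distinct xs \<and> set xs = V \<and>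
      E = {{xs ! i, xs ! Suc i} | i. Suc i < length xs})"

end

theory Submission
  imports Defs "HOL-Library.Multiset"
begin

text \<open>Deleting a set \<open>S\<close> of edges of a tree earns the credit \<open>|E| - 3 |S|\<close>, which has to be
  made nonnegative while the rest becomes locally irregular. Root the tree. The branch at a child
  \<open>x\<close>, including the edge above \<open>x\<close>, matters to the parent only through the pairs of the final degree
  of \<open>x\<close> (or 0 if the edge above \<open>x\<close> is deleted) and the credit that the branch can reach with it.
  For these pairs seven lower bounds (\<^emph>\<open>kinds\<close>) suffice: whatever the kinds of the children, the
  branch above them has one of the seven kinds again. A tree that is not a path is rooted at a vertex
  of degree at least 3, and three or more branches of the seven kinds always combine to a nonnegative
  credit.\<close>

section \<open>Rooted trees\<close>

text \<open>A graft hangs one whole branch below the root, so induction handles the children of a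
  vertex one at a time and has a hypothesis for the new branch too.\<close>

inductive rtree :: "'a \<Rightarrow> 'a set \<Rightarrow> 'a set set \<Rightarrow> bool" where
  single: "rtree r {r} {}"
| graft: "rtree r V E \<Longrightarrow> rtree x W D \<Longrightarrow> V \<inter> W = {} \<Longrightarrow>
    rtree r (V \<union> W) (insert {r, x} (E \<union> D))"

lemma rtree_basic:
  "rtree r V E \<Longrightarrow> finite V \<and> finite E \<and> r \<in> V \<and> \<Union>E \<subseteq> V"
  by (induction rule: rtree.induct) auto

lemma rtree_graft_disjoint:
  assumes "rtree r V E" "rtree x W D" "V \<inter> W = {}"
  shows "E \<inter> D = {}" "{r, x} \<notin> E" "{r, x} \<notin> D"
proof -
  have ne: "{} \<notin> D"
    using assms(2) by (induction rule: rtree.induct) auto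
  have sub: "\<Union>E \<subseteq> V" "\<Union>D \<subseteq> W" "r \<in> V" "x \<in> W"
    using rtree_basic[OF assms(1)] rtree_basic[OF assms(2)] by auto
  show "E \<inter> D = {}"
  proof (rule ccontr)
    assume "E \<inter> D \<noteq> {}"
    then obtain e where e: "e \<in> E" "e \<in> D" by auto
    then have "e \<subseteq> V \<inter> W" using sub by blast
    then show False using e ne assms(3) by auto
  qed
  show "{r, x} \<notin> E" "{r, x} \<notin> D" using sub assms(3) by auto
qed

text \<open>Grafting acts only at the root; a leaf deeper down is passed by induction to the side of
  the last graft that contains \<open>v\<close>.\<close>

lemma rtree_add_leaf:
  assumes "rtree r V E" "v \<in> V" "u \<notin> V"
  shows "rtree r (insert u V) (insert {v, u} E)"
  using assms
proof (induction rule: rtree.induct)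
  case (single r)
  then have "rtree r ({r} \<union> {u}) (insert {r, u} ({} \<union> {}))"
    by (intro rtree.graft rtree.single) simp
  moreover have "v = r" using single by simp
  moreover have "{r} \<union> {u} = insert u {r}" by blast
  ultimately show ?case by simp
next
  case (graft r V E x W D)
  show ?case
  proof (cases "v \<in> V")
    case True
    then have "rtree r (insert u V) (insert {v, u} E)" using graft by simp
    moreover have "insert u V \<inter> W = {}" using graft by simp
    ultimately have "rtree r (insert u V \<union> W) (insert {r, x} (insert {v, u} E \<union> D))"
      using graft(2) rtree.graft by metis
    then show ?thesis by (simp only: Un_insert_left insert_commute[of "{v, u}" "{r, x}"])
  next
    case False
    then have "rtree x (insert u W) (insert {v, u} D)" using graft by simp
    moreover have "V \<inter> insert u W = {}" using graft by simp
    ultimately have "rtree r (V \<union> insert u W) (insert {r, x} (E \<union> insert {v, u} D))"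
      using graft(1) rtree.graft by metis
    then show ?thesis by (simp only: Un_insert_right insert_commute[of "{v, u}" "{r, x}"])
  qed
qed

section \<open>Walks, cycles and the rooting of a tree\<close>

definition walk :: "'a set set \<Rightarrow> 'a list \<Rightarrow> bool" where
  "walk E xs \<longleftrightarrow> xs \<noteq> [] \<and> (\<forall>i. Suc i < length xs \<longrightarrow> adj E (xs ! i) (xs ! Suc i))"

lemma walk_append:
  assumes "walk E xs" "walk E ys" "adj E (last xs) (hd ys)"
  shows "walk E (xs @ ys)"
  unfolding walk_def
proof (intro conjI allI impI)
  show "xs @ ys \<noteq> []" using assms by (simp add: walk_def)
  fix i assume i: "Suc i < length (xs @ ys)"
  consider "Suc i < length xs" | "Suc i = length xs" | "length xs \<le> i" by linarith
  then show "adj E ((xs @ ys) ! i) ((xs @ ys) ! Suc i)"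
  proof cases
    case 1
    then show ?thesis using assms by (simp add: walk_def nth_append)
  next
    case 2
    then have "xs ! i = last xs" using assms(1) by (metis diff_Suc_1 last_conv_nth walk_def)
    moreover have "ys ! 0 = hd ys" using assms(2) by (simp add: hd_conv_nth walk_def)
    ultimately show ?thesis using 2 assms(3) by (simp add: nth_append)
  next
    case 3
    then have "Suc (i - length xs) < length ys" using i by auto
    then have "adj E (ys ! (i - length xs)) (ys ! Suc (i - length xs))"
      using assms(2) by (simp add: walk_def)
    then show ?thesis using 3 by (simp add: nth_append Suc_diff_le)
  qed
qed

lemma walk_mono: "walk E xs \<Longrightarrow> E \<subseteq> D \<Longrightarrow> walk D xs"
  by (auto simp: walk_def adj_def)

lemma rtree_path:
  assumes "rtree r V E" "u \<in> V" "v \<in> V"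
  shows "\<exists>xs. walk E xs \<and> distinct xs \<and> set xs \<subseteq> V \<and> hd xs = u \<and> last xs = v"
  using assms
proof (induction arbitrary: u v rule: rtree.induct)
  case (single r)
  then show ?case by (intro exI[of _ "[r]"]) (auto simp: walk_def)
next
  case (graft r V E x W D)
  let ?E = "insert {r, x} (E \<union> D)"
  have rx: "r \<in> V" "x \<in> W" "r \<noteq> x"
    using rtree_basic[OF graft(1)] rtree_basic[OF graft(2)] graft(3) by auto
  have join: "\<exists>zs. walk ?E zs \<and> distinct zs \<and> set zs \<subseteq> V \<union> W \<and> hd zs = hd xs \<and> last zs = last ys"
    if "walk ?E xs" "walk ?E ys" "distinct xs" "distinct ys"
      "set xs \<subseteq> V \<and> set ys \<subseteq> W \<or> set xs \<subseteq> W \<and> set ys \<subseteq> V"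
      "{last xs, hd ys} = {r, x}" for xs ys
  proof -
    have "adj ?E (last xs) (hd ys)" using that(6) rx(3) by (auto simp: adj_def doubleton_eq_iff)
    then have "walk ?E (xs @ ys)" using walk_append that by blast
    then show ?thesis using that graft(3)
      by (intro exI[of _ "xs @ ys"]) (auto simp: walk_def)
  qed
  have EV: "\<exists>xs. walk ?E xs \<and> distinct xs \<and> set xs \<subseteq> V \<and> hd xs = u \<and> last xs = v"
    if "u \<in> V" "v \<in> V" for u v
    using graft(4)[OF that] walk_mono[of E _ ?E] by blast
  have DW: "\<exists>xs. walk ?E xs \<and> distinct xs \<and> set xs \<subseteq> W \<and> hd xs = u \<and> last xs = v"
    if "u \<in> W" "v \<in> W" for u v
    using graft(5)[OF that] walk_mono[of D _ ?E] by blast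
  consider "u \<in> V" "v \<in> V" | "u \<in> W" "v \<in> W" | "u \<in> V" "v \<in> W" | "u \<in> W" "v \<in> V"
    using graft by blast
  then show ?case
  proof cases
    case 1 then show ?thesis using EV[OF 1] by blast
  next
    case 2 then show ?thesis using DW[OF 2] by blast
  next
    case 3
    obtain xs ys where "walk ?E xs" "distinct xs" "set xs \<subseteq> V" "hd xs = u" "last xs = r"
      "walk ?E ys" "distinct ys" "set ys \<subseteq> W" "hd ys = x" "last ys = v"
      using EV[OF 3(1) rx(1)] DW[OF rx(2) 3(2)] by blast
    then show ?thesis using join[of xs ys] by auto
  next
    case 4
    obtain xs ys where "walk ?E xs" "distinct xs" "set xs \<subseteq> W" "hd xs = u" "last xs = x"
      "walk ?E ys" "distinct ys" "set ys \<subseteq> V" "hd ys = r" "last ys = v"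
      using DW[OF 4(1) rx(2)] EV[OF rx(1) 4(2)] by blast
    then show ?thesis using join[of xs ys] by (auto simp: insert_commute)
  qed
qed

text \<open>Otherwise the path from \<open>v\<close> to \<open>w\<close> inside \<open>U\<close>,
  closed up through \<open>u\<close>, would be a cycle.\<close>

lemma acyclic_one_edge:
  assumes "rtree r U (E \<inter> Pow U)" "\<not> has_cycle E" "u \<notin> U"
    "v \<in> U" "w \<in> U" "{v, u} \<in> E" "{w, u} \<in> E"
  shows "v = w"
proof (rule ccontr)
  assume ne: "v \<noteq> w"
  obtain xs where xs: "walk (E \<inter> Pow U) xs" "distinct xs" "set xs \<subseteq> U" "hd xs = v" "last xs = w"
    using rtree_path[OF assms(1,4,5)] by blast
  have nz: "xs \<noteq> []" using xs by (simp add: walk_def)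
  have w2: "walk E xs" using xs(1) walk_mono by blast
  have "walk E [u]" by (simp add: walk_def)
  moreover have "adj E (last xs) (hd [u])" using assms xs by (auto simp: adj_def)
  ultimately have W: "walk E (xs @ [u])" using walk_append w2 by blast
  have "length xs \<ge> 2"
  proof (rule ccontr)
    assume "\<not> 2 \<le> length xs"
    then obtain y where "xs = [y]" using nz by (cases xs; cases "tl xs") auto
    then show False using xs ne by simp
  qed
  then have "length (xs @ [u]) \<ge> 3" by simp
  moreover have "distinct (xs @ [u])" using xs assms by auto
  moreover have "adj E (last (xs @ [u])) (hd (xs @ [u]))"
    using nz xs assms by (auto simp: adj_def insert_commute)
  ultimately have "has_cycle E" using W unfolding has_cycle_def walk_def by blast
  then show False using assms by simp
qed

lemma tree_rtree:
  assumes "tree V E" "r \<in> V"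
  shows "rtree r V E"
proof -
  txt \<open>A maximal vertex set whose induced subgraph is a rooted tree is all of \<open>V\<close>.\<close>
  have fin: "finite V" and edge: "\<And>e. e \<in> E \<Longrightarrow> \<exists>u v. u \<noteq> v \<and> u \<in> V \<and> v \<in> V \<and> e = {u, v}"
    and conn: "connected_graph V E" and acyc: "\<not> has_cycle E"
    using assms by (auto simp: tree_def simple_graph_def)
  define \<U> where "\<U> = {U. U \<subseteq> V \<and> rtree r U (E \<inter> Pow U)}"
  have "E \<inter> Pow {r} = {}" using edge by fastforce
  then have "{r} \<in> \<U>" using assms(2) by (simp add: \<U>_def rtree.single)
  moreover have "finite \<U>" using fin by (simp add: \<U>_def)
  ultimately obtain U where U: "U \<in> \<U>" and max: "\<And>W. W \<in> \<U> \<Longrightarrow> U \<subseteq> W \<Longrightarrow> U = W"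
    using finite_has_maximal[of \<U>] by blast
  have rU: "rtree r U (E \<inter> Pow U)" and UV: "U \<subseteq> V" using U by (auto simp: \<U>_def)
  have r: "r \<in> U" using rtree_basic[OF rU] by blast
  have "U = V"
  proof (rule ccontr)
    assume "U \<noteq> V"
    then obtain y where y: "y \<in> V" "y \<notin> U" using UV by blast
    have "(r, y) \<in> {(x, y). adj E x y}\<^sup>*" using conn assms(2) y by (simp add: connected_graph_def)
    then have "\<exists>v u. v \<in> U \<and> u \<notin> U \<and> adj E v u" using y(2)
    proof (induction rule: rtrancl_induct)
      case base then show ?case using r by simp
    next
      case (step a b) then show ?case by blast
    qed
    then obtain v u where vu: "v \<in> U" "u \<notin> U" "{v, u} \<in> E" by (auto simp: adj_def)
    \<comment> \<open>Acyclicity leaves \<open>{v, u}\<close> as the only edge from \<open>u\<close>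
      into \<open>U\<close>, so adding \<open>u\<close> to \<open>U\<close> just adds a leaf,
      against maximality.\<close>
    have "E \<inter> Pow (insert u U) \<subseteq> insert {v, u} (E \<inter> Pow U)"
    proof
      fix e assume e: "e \<in> E \<inter> Pow (insert u U)"
      show "e \<in> insert {v, u} (E \<inter> Pow U)"
      proof (cases "u \<in> e")
        case True
        obtain a b where ab: "a \<noteq> b" "e = {a, b}" using edge e by blast
        then obtain w where w: "e = {w, u}" "w \<noteq> u" using True by (auto simp: insert_commute)
        then have "w \<in> U" using e by auto
        then have "v = w" using acyclic_one_edge[OF rU acyc vu(2,1)] vu w e by auto
        then show ?thesis using w by simp
      next
        case False
        then show ?thesis using e by auto
      qed
    qed
    then have "E \<inter> Pow (insert u U) = insert {v, u} (E \<inter> Pow U)" using vu by auto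
    then have "rtree r (insert u U) (E \<inter> Pow (insert u U))"
      using rtree_add_leaf[OF rU vu(1,2)] by simp
    moreover have "u \<in> V" using edge[OF vu(3)] vu by (auto simp: doubleton_eq_iff)
    ultimately have "insert u U \<in> \<U>" using UV by (simp add: \<U>_def)
    then show False using max vu by blast
  qed
  moreover have "E \<subseteq> Pow V" using edge by blast
  ultimately show ?thesis using rU by (simp add: Int_absorb2)
qed

section \<open>Degrees under a graft\<close>

lemma degree_Un_left: "v \<notin> \<Union>G \<Longrightarrow> degree (F \<union> G) v = degree F v"
  unfolding degree_def by (rule arg_cong[of _ _ card]) auto

lemma degree_Un_right: "v \<notin> \<Union>F \<Longrightarrow> degree (F \<union> G) v = degree G v"
  unfolding degree_def by (rule arg_cong[of _ _ card]) auto

lemma degree_insert: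
  assumes "finite F" "e \<notin> F"
  shows "degree (insert e F) v = degree F v + (if v \<in> e then 1 else 0)"
proof -
  have "{f \<in> insert e F. v \<in> f} = (if v \<in> e then insert e {f \<in> F. v \<in> f} else {f \<in> F. v \<in> f})"
    by auto
  then show ?thesis using assms by (simp add: degree_def)
qed

lemma degree_graft:
  assumes "finite F" "finite G" "\<Union>F \<subseteq> V" "\<Union>G \<subseteq> W" "V \<inter> W = {}" "r \<in> V" "x \<in> W"
  shows "v \<in> V \<Longrightarrow> degree (F \<union> G) v = degree F v"
    and "v \<in> W \<Longrightarrow> degree (F \<union> G) v = degree G v"
    and "v \<in> V \<Longrightarrow> degree (insert {r, x} (F \<union> G)) v = degree F v + (if v = r then 1 else 0)"
    and "v \<in> W \<Longrightarrow> degree (insert {r, x} (F \<union> G)) v = degree G v + (if v = x then 1 else 0)"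
proof -
  have new: "{r, x} \<notin> F \<union> G" using assms by blast
  show l: "degree (F \<union> G) v = degree F v" if "v \<in> V"
    by (rule degree_Un_left) (use assms that in blast)
  show m: "degree (F \<union> G) v = degree G v" if "v \<in> W"
    by (rule degree_Un_right) (use assms that in blast)
  show "degree (insert {r, x} (F \<union> G)) v = degree F v + (if v = r then 1 else 0)" if "v \<in> V"
    using degree_insert[OF _ new] l[OF that] assms that by auto
  show "degree (insert {r, x} (F \<union> G)) v = degree G v + (if v = x then 1 else 0)" if "v \<in> W"
    using degree_insert[OF _ new] m[OF that] assms that by auto
qed

section \<open>Trees of maximum degree two\<close>

text \<open>The edge set demanded by \<open>is_path_graph\<close>, named so that it can be computed
  by recursion on the list.\<close>

definition consec :: "'a list \<Rightarrow> 'a set set" where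
  "consec xs = {{xs ! i, xs ! Suc i} | i. Suc i < length xs}"

lemma consec_simps [simp]:
  "consec [] = {}" "consec [a] = {}" "consec (a # b # xs) = insert {a, b} (consec (b # xs))"
proof -
  show "consec (a # b # xs) = insert {a, b} (consec (b # xs))"
  proof (intro equalityI subsetI)
    fix e assume "e \<in> consec (a # b # xs)"
    then obtain i where i: "Suc i < length (a # b # xs)"
      "e = {(a # b # xs) ! i, (a # b # xs) ! Suc i}"
      unfolding consec_def by blast
    then show "e \<in> insert {a, b} (consec (b # xs))"
      by (cases i) (auto simp: consec_def)
  next
    fix e assume "e \<in> insert {a, b} (consec (b # xs))"
    then consider "e = {a, b}" | i where "Suc i < length (b # xs)" "e = {(b # xs) ! i, (b # xs) ! Suc i}"
      unfolding consec_def by blast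
    then show "e \<in> consec (a # b # xs)"
    proof cases
      case 1
      then show ?thesis unfolding consec_def by (intro CollectI exI[of _ 0]) simp
    next
      case (2 i)
      then show ?thesis unfolding consec_def by (intro CollectI exI[of _ "Suc i"]) simp
    qed
  qed
qed (simp_all add: consec_def)

lemma consec_append:
  "xs \<noteq> [] \<Longrightarrow> ys \<noteq> [] \<Longrightarrow>
    consec (xs @ ys) = insert {last xs, hd ys} (consec xs \<union> consec ys)"
proof (induction xs)
  case (Cons a xs)
  then show ?case by (cases xs; cases ys) auto
qed simp

lemma consec_rev: "consec (rev xs) = consec xs"
proof (induction xs)
  case (Cons a xs)
  show ?case
  proof (cases "xs = []")
    case False
    then have "consec (rev (a # xs)) = insert {hd xs, a} (consec xs)"
      using Cons by (simp add: consec_append last_rev)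
    then show ?thesis using False by (cases xs) (auto simp: insert_commute)
  qed simp
qed simp

lemma degree_mono: "finite E \<Longrightarrow> F \<subseteq> E \<Longrightarrow> degree F v \<le> degree E v"
  unfolding degree_def by (rule card_mono) auto

lemma rtree_graft_degree:
  assumes "rtree r V E" "rtree x W D" "V \<inter> W = {}"
  shows "degree (insert {r, x} (E \<union> D)) r = Suc (degree E r)"
    and "degree (insert {r, x} (E \<union> D)) x = Suc (degree D x)"
    and "degree E v \<le> degree (insert {r, x} (E \<union> D)) v"
    and "degree D v \<le> degree (insert {r, x} (E \<union> D)) v"
proof -
  have basic: "finite E" "finite D" "\<Union>E \<subseteq> V" "\<Union>D \<subseteq> W" "r \<in> V" "x \<in> W"
    using rtree_basic[OF assms(1)] rtree_basic[OF assms(2)] by auto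
  note deg = degree_graft[OF basic(1-4) assms(3) basic(5,6)]
  show "degree (insert {r, x} (E \<union> D)) r = Suc (degree E r)" using deg(3)[of r] basic by simp
  show "degree (insert {r, x} (E \<union> D)) x = Suc (degree D x)" using deg(4)[of x] basic by simp
  show "degree E v \<le> degree (insert {r, x} (E \<union> D)) v"
    "degree D v \<le> degree (insert {r, x} (E \<union> D)) v"
    using basic by (auto intro!: degree_mono)
qed

lemma rtree_degree_0:
  assumes "rtree r V E" "degree E r = 0"
  shows "V = {r} \<and> E = {}"
  using assms(1)
proof cases
  case (graft V' E' x W D)
  then show ?thesis using rtree_graft_degree(1)[OF graft(3-5)] assms by simp
qed simp

text \<open>The last graft already uses up the degree of the root, so what it was applied to is a
  single vertex. The child \<open>x\<close> has degree at most 1 in its own branch, and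
  \<open>r\<close> goes in front of its path.\<close>

lemma rtree_path_from_root:
  assumes "rtree r V E" "degree E r \<le> 1" "\<forall>v. degree E v \<le> 2"
  shows "\<exists>xs. xs \<noteq> [] \<and> distinct xs \<and> set xs = V \<and> E = consec xs \<and> hd xs = r"
  using assms
proof (induction rule: rtree.induct)
  case (single r)
  then show ?case by (intro exI[of _ "[r]"]) auto
next
  case (graft r V E x W D)
  note deg = rtree_graft_degree[OF graft(1-3)]
  have two: "degree (insert {r, x} (E \<union> D)) v \<le> 2" for v using graft(7) by blast
  have "degree E r = 0" using graft(6) deg(1) by simp
  then have VE: "V = {r}" "E = {}" using rtree_degree_0[OF graft(1)] by auto
  have "degree D x \<le> 1" using two[of x] deg(2) by simp
  moreover have "\<forall>v. degree D v \<le> 2" using two deg(4) le_trans by blast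
  ultimately obtain xs where xs: "xs \<noteq> []" "distinct xs" "set xs = W" "D = consec xs" "hd xs = x"
    using graft(5) by blast
  have "consec (r # xs) = insert {r, x} (E \<union> D)" using xs VE by (cases xs) auto
  then show ?case using xs VE graft(3) by (intro exI[of _ "r # xs"]) auto
qed

text \<open>Without the edge of the last graft both its ends have degree at most 1; the paths
  starting there are joined, the first one reversed.\<close>

lemma rtree_is_path_graph:
  assumes "rtree r V E" "\<forall>v. degree E v \<le> 2"
  shows "is_path_graph V E"
  using assms(1)
proof cases
  case single
  then show ?thesis unfolding is_path_graph_def by (intro exI[of _ "[r]"]) auto
next
  case (graft V' E' x W D)
  note deg = rtree_graft_degree[OF graft(3-5)]
  have two: "degree (insert {r, x} (E' \<union> D)) v \<le> 2" for v using assms(2) graft(2) by simp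
  have "degree E' r \<le> 1" "degree D x \<le> 1" using two[of r] two[of x] deg(1,2) by simp_all
  moreover have "\<forall>v. degree E' v \<le> 2" "\<forall>v. degree D v \<le> 2"
    using two deg(3,4) le_trans by blast+
  ultimately obtain xs ys where
    xs: "xs \<noteq> []" "distinct xs" "set xs = V'" "E' = consec xs" "hd xs = r" and
    ys: "ys \<noteq> []" "distinct ys" "set ys = W" "D = consec ys" "hd ys = x"
    using rtree_path_from_root[OF graft(3)] rtree_path_from_root[OF graft(4)] by blast
  have "E = consec (rev xs @ ys)"
    using xs ys graft(2) by (simp add: consec_append consec_rev last_rev)
  moreover have "distinct (rev xs @ ys)" "set (rev xs @ ys) = V" "rev xs @ ys \<noteq> []"
    using xs ys graft by auto
  ultimately show ?thesis
    unfolding is_path_graph_def consec_def[symmetric] by blast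
qed

section \<open>Partial solutions\<close>

text \<open>\<open>A\<close> contains the degrees of the neighbours of \<open>r\<close>. Conflicts at \<open>r\<close> itself are tolerated since
  its degree may still grow.\<close>

definition partial_sol :: "'a \<Rightarrow> 'a set set \<Rightarrow> nat \<Rightarrow> nat set \<Rightarrow> int \<Rightarrow> bool" where
  "partial_sol r E d A c \<longleftrightarrow> (\<exists>F\<subseteq>E. degree F r = d \<and> (\<forall>u. adj F r u \<longrightarrow> degree F u \<in> A) \<and>
     (\<forall>u v. u \<noteq> r \<longrightarrow> v \<noteq> r \<longrightarrow> adj F u v \<longrightarrow> degree F u \<noteq> degree F v) \<and>
     c \<le> int (card E) - 3 * int (card (E - F)))"

lemma adj_sym: "adj E u v \<Longrightarrow> adj E v u"
  by (auto simp: adj_def insert_commute)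

text \<open>Deleting \<open>{r, x}\<close> makes \<open>d'\<close> final, so conflicts tolerated at
  \<open>x\<close> must be excluded now. The new edge counts 1 and its deletion costs 3, hence
  -2.\<close>

lemma partial_sol_cut:
  assumes "rtree r V E" "rtree x W D" "V \<inter> W = {}"
    and "partial_sol r E d A c" "partial_sol x D d' A' c'" "d' \<notin> A'"
  shows "partial_sol r (insert {r, x} (E \<union> D)) d A (c + (c' - 2))"
proof -
  have basic: "finite E" "finite D" "\<Union>E \<subseteq> V" "\<Union>D \<subseteq> W" "r \<in> V" "x \<in> W"
    using rtree_basic[OF assms(1)] rtree_basic[OF assms(2)] by auto
  obtain F where F: "F \<subseteq> E" "degree F r = d" "\<forall>u. adj F r u \<longrightarrow> degree F u \<in> A"
    "\<forall>u v. u \<noteq> r \<longrightarrow> v \<noteq> r \<longrightarrow> adj F u v \<longrightarrow> degree F u \<noteq> degree F v"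
    "c \<le> int (card E) - 3 * int (card (E - F))"
    using assms(4) unfolding partial_sol_def by blast
  obtain G where G: "G \<subseteq> D" "degree G x = d'" "\<forall>u. adj G x u \<longrightarrow> degree G u \<in> A'"
    "\<forall>u v. u \<noteq> x \<longrightarrow> v \<noteq> x \<longrightarrow> adj G u v \<longrightarrow> degree G u \<noteq> degree G v"
    "c' \<le> int (card D) - 3 * int (card (D - G))"
    using assms(5) unfolding partial_sol_def by blast
  have FV: "\<Union>F \<subseteq> V" "\<Union>G \<subseteq> W" "finite F" "finite G" 
    using F(1) G(1) basic finite_subset by blast+
  note deg = degree_graft(1,2)[OF FV(3,4,1,2) assms(3) basic(5,6)]
  have adjF: "u \<in> V \<and> v \<in> V" if "adj F u v" for u v using that FV by (auto simp: adj_def)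
  have adjG: "u \<in> W \<and> v \<in> W" if "adj G u v" for u v using that FV by (auto simp: adj_def)
  have adjU: "adj F u v \<or> adj G u v" if "adj (F \<union> G) u v" for u v using that by (auto simp: adj_def)
  have irrG: "degree G u \<noteq> degree G v" if "adj G u v" for u v
    using G(2-4) that adj_sym[OF that] assms(6) by metis
  note disj = rtree_graft_disjoint[OF assms(1-3)]
  show ?thesis unfolding partial_sol_def
  proof (intro exI[of _ "F \<union> G"] conjI allI impI)
    show "F \<union> G \<subseteq> insert {r, x} (E \<union> D)" using F G by blast
    show "degree (F \<union> G) r = d" using deg basic F by simp
    show "degree (F \<union> G) u \<in> A" if "adj (F \<union> G) r u" for u
    proof -
      have "adj F r u" using adjU[OF that] adjG basic assms(3) by blast
      then show ?thesis using F(3) deg(1) adjF by auto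
    qed
    show "degree (F \<union> G) u \<noteq> degree (F \<union> G) v" if "u \<noteq> r" "v \<noteq> r" "adj (F \<union> G) u v" for u v
      using adjU[OF that(3)] deg adjF[of u v] adjG[of u v] F(4) irrG[of u v] that by auto
    have "insert {r, x} (E \<union> D) - (F \<union> G) = insert {r, x} ((E - F) \<union> (D - G))"
      using disj F(1) G(1) by blast
    moreover have "card (insert {r, x} ((E - F) \<union> (D - G))) = Suc (card (E - F) + card (D - G))"
      using disj basic by (subst card_insert_disjoint) (auto intro!: card_Un_disjoint)
    moreover have "card (insert {r, x} (E \<union> D)) = Suc (card E + card D)"
      using disj basic by (subst card_insert_disjoint) (auto intro!: card_Un_disjoint)
    ultimately show "c + (c' - 2) \<le> int (card (insert {r, x} (E \<union> D)))
        - 3 * int (card (insert {r, x} (E \<union> D) - (F \<union> G)))"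
      using F(5) G(5) by simp
  qed
qed

text \<open>Keeping \<open>{r, x}\<close> makes \<open>Suc d'\<close> the final degree of
  \<open>x\<close>. A conflict between \<open>r\<close> and \<open>x\<close> is postponed by
  recording \<open>Suc d'\<close>.\<close>

lemma partial_sol_keep:
  assumes "rtree r V E" "rtree x W D" "V \<inter> W = {}"
    and "partial_sol r E d A c" "partial_sol x D d' A' c'" "Suc d' \<notin> A'"
  shows "partial_sol r (insert {r, x} (E \<union> D)) (Suc d) (insert (Suc d') A) (c + (c' + 1))"
proof -
  have basic: "finite E" "finite D" "\<Union>E \<subseteq> V" "\<Union>D \<subseteq> W" "r \<in> V" "x \<in> W"
    using rtree_basic[OF assms(1)] rtree_basic[OF assms(2)] by auto
  obtain F where F: "F \<subseteq> E" "degree F r = d" "\<forall>u. adj F r u \<longrightarrow> degree F u \<in> A"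
    "\<forall>u v. u \<noteq> r \<longrightarrow> v \<noteq> r \<longrightarrow> adj F u v \<longrightarrow> degree F u \<noteq> degree F v"
    "c \<le> int (card E) - 3 * int (card (E - F))"
    using assms(4) unfolding partial_sol_def by blast
  obtain G where G: "G \<subseteq> D" "degree G x = d'" "\<forall>u. adj G x u \<longrightarrow> degree G u \<in> A'"
    "\<forall>u v. u \<noteq> x \<longrightarrow> v \<noteq> x \<longrightarrow> adj G u v \<longrightarrow> degree G u \<noteq> degree G v"
    "c' \<le> int (card D) - 3 * int (card (D - G))"
    using assms(5) unfolding partial_sol_def by blast
  have FV: "\<Union>F \<subseteq> V" "\<Union>G \<subseteq> W" "finite F" "finite G" 
    using F(1) G(1) basic finite_subset by blast+
  let ?H = "insert {r, x} (F \<union> G)"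
  note deg = degree_graft(3,4)[OF FV(3,4,1,2) assms(3) basic(5,6)]
  have adjF: "u \<in> V \<and> v \<in> V \<and> u \<noteq> v" if "adj F u v" for u v using that FV by (auto simp: adj_def)
  have adjG: "u \<in> W \<and> v \<in> W \<and> u \<noteq> v" if "adj G u v" for u v using that FV by (auto simp: adj_def)
  have adjU: "adj F u v \<or> adj G u v \<or> u = r \<and> v = x \<or> u = x \<and> v = r" if "adj ?H u v" for u v
    using that by (auto simp: adj_def doubleton_eq_iff)
  have irrG: "degree ?H u \<noteq> degree ?H v" if a: "adj G u v" for u v
  proof -
    have uv: "u \<in> W" "v \<in> W" "u \<noteq> v" using adjG a by auto
    show ?thesis
    proof (cases "u = x \<or> v = x")
      case True
      then show ?thesis using G(2,3) a adj_sym[OF a] assms(6) deg(2) uv by auto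
    next
      case False
      then show ?thesis using G(4) a deg(2) uv by auto
    qed
  qed
  note disj = rtree_graft_disjoint[OF assms(1-3)]
  show ?thesis unfolding partial_sol_def
  proof (intro exI[of _ ?H] conjI allI impI)
    show "?H \<subseteq> insert {r, x} (E \<union> D)" using F G by blast
    show "degree ?H r = Suc d" using deg(1) basic F by simp
    show "degree ?H u \<in> insert (Suc d') A" if "adj ?H r u" for u
    proof -
      have "adj F r u \<or> u = x" using adjU[OF that] adjG basic assms(3) by blast
      then show ?thesis
      proof
        assume "adj F r u"
        then show ?thesis using F(3) deg(1) adjF[of r u] by auto
      next
        assume "u = x"
        then show ?thesis using deg(2)[of x] basic G(2) by simp
      qed
    qed
    show "degree ?H u \<noteq> degree ?H v" if "u \<noteq> r" "v \<noteq> r" "adj ?H u v" for u v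
      using adjU[OF that(3)] deg(1) adjF[of u v] F(4) irrG[of u v] that by auto
    have "insert {r, x} (E \<union> D) - ?H = (E - F) \<union> (D - G)"
      using disj F(1) G(1) by blast
    moreover have "card ((E - F) \<union> (D - G)) = card (E - F) + card (D - G)"
      using disj basic by (intro card_Un_disjoint) auto
    moreover have "card (insert {r, x} (E \<union> D)) = Suc (card E + card D)"
      using disj basic by (subst card_insert_disjoint) (auto intro!: card_Un_disjoint)
    ultimately show "c + (c' + 1) \<le> int (card (insert {r, x} (E \<union> D)))
        - 3 * int (card (insert {r, x} (E \<union> D) - ?H))"
      using F(5) G(5) by simp
  qed
qed

section \<open>Combining branches\<close>

text \<open>Typical branches, counting the edge above: \<open>Open1\<close> is a single edge, \<open>Open2\<close> a path with two
  edges; \<open>Open3\<close> has a top vertex with two children of the kinds \<open>Open1\<close> and \<open>Open2\<close>, not both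
  \<open>Open1\<close>; \<open>Open4\<close> has a top vertex with one child of kind \<open>Open3\<close>, one of kind \<open>Open2\<close> and a third one
  of kind \<open>Open1\<close> or \<open>Open2\<close>; \<open>Path3\<close> is a path with three edges. For the last three kinds the edge
  above can be deleted without loss. A pair consists of the degree of the top vertex, 0 meaning that
  the edge above is deleted, and the credit.\<close>

datatype kind = Open1 | Open2 | Open3 | Open4 | Spare | Path3 | Tight

fun opts :: "kind \<Rightarrow> (nat \<times> int) set" where
  "opts Open1 = {(0, -2), (1, 1)}"
| "opts Open2 = {(0, -4), (1, -1), (2, 2)}"
| "opts Open3 = {(0, -4), (2, -4), (3, 4)}"
| "opts Open4 = {(0, -2), (4, 8)}"
| "opts Spare = {(0, 2)}"
| "opts Path3 = {(0, 0), (2, 0)}"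
| "opts Tight = {(0, 0), (2, -2), (3, -1)}"

text \<open>\<open>X\<close> attaches to each branch one option of its kind; branches of equal kind
  may use different options.\<close>

definition choice :: "kind multiset \<Rightarrow> (kind \<times> nat \<times> int) multiset \<Rightarrow> bool" where
  "choice M X \<longleftrightarrow> image_mset fst X = M \<and> (\<forall>x\<in>#X. snd x \<in> opts (fst x))"

definition top_degree :: "(kind \<times> nat \<times> int) multiset \<Rightarrow> nat" where
  "top_degree X = size {#x \<in># X. fst (snd x) \<noteq> 0#}"

definition child_degrees :: "(kind \<times> nat \<times> int) multiset \<Rightarrow> nat set" where
  "child_degrees X = {s. s \<noteq> 0 \<and> s \<in># image_mset (\<lambda>x. fst (snd x)) X}"

definition credit :: "(kind \<times> nat \<times> int) multiset \<Rightarrow> int" where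
  "credit X = (\<Sum>x\<in>#X. snd (snd x))"

lemma choice_add_mset:
  assumes "choice (add_mset k M) X"
  obtains s c Y where "X = add_mset (k, s, c) Y" "(s, c) \<in> opts k" "choice M Y"
    "top_degree X = top_degree Y + (if s = 0 then 0 else 1)"
    "child_degrees X = (if s = 0 then {} else {s}) \<union> child_degrees Y"
    "credit X = credit Y + c"
proof -
  obtain x Y where "X = add_mset x Y" "fst x = k" "image_mset fst Y = M"
    using assms by (auto simp: choice_def dest!: msed_map_invR)
  moreover obtain s c where "x = (k, s, c)" using calculation(2) by (cases x) auto
  ultimately have X: "X = add_mset (k, s, c) Y" and "image_mset fst Y = M" by auto
  then have "choice M Y" "(s, c) \<in> opts k" using assms by (auto simp: choice_def)
  moreover have "top_degree X = top_degree Y + (if s = 0 then 0 else 1)"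
    "child_degrees X = (if s = 0 then {} else {s}) \<union> child_degrees Y" "credit X = credit Y + c"
    using X by (auto simp: top_degree_def child_degrees_def credit_def)
  ultimately show thesis using that X by blast
qed

lemma ball_replicate_mset: "(\<forall>x\<in>#replicate_mset n y. P x) \<longleftrightarrow> n = 0 \<or> P y"
  by auto

lemma top_degree_simps:
  "top_degree (X + Y) = top_degree X + top_degree Y"
  "top_degree (replicate_mset n (k, s, c)) = (if s = 0 then 0 else n)"
  by (simp add: top_degree_def) (induction n; simp add: top_degree_def)

lemma child_degrees_simps:
  "child_degrees (X + Y) = child_degrees X \<union> child_degrees Y"
  "child_degrees (replicate_mset n (k, s, c)) = {t. t = s \<and> s \<noteq> 0 \<and> 0 < n}"
  by (auto simp: child_degrees_def)

lemma credit_simps: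
  "credit (X + Y) = credit X + credit Y"
  "credit (replicate_mset n (k, s, c)) = int n * c"
  by (simp_all add: credit_def)

text \<open>What a branch whose top vertex has children of kinds \<open>M\<close> offers its parent.
  A deleted edge above costs 2; a kept one adds 1 to degree and credit. The conflict with the parent
  is left to the parent.\<close>

definition branch_option :: "kind multiset \<Rightarrow> nat \<times> int \<Rightarrow> bool" where
  "branch_option M = (\<lambda>(s, c).
     if s = 0 then \<exists>X. choice M X \<and> top_degree X \<notin> child_degrees X \<and> c \<le> credit X - 2
     else \<exists>X. choice M X \<and> s = Suc (top_degree X) \<and> s \<notin> child_degrees X \<and> c \<le> credit X + 1)"

definition behaves :: "kind multiset \<Rightarrow> kind \<Rightarrow> bool" where
  "behaves M k \<longleftrightarrow> (\<forall>sc\<in>opts k. branch_option M sc)"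

section \<open>Explicit choices given by counts\<close>

lemma multiset_kind_eq:
  "M = replicate_mset (count M Open1) Open1 + replicate_mset (count M Open2) Open2
     + replicate_mset (count M Open3) Open3 + replicate_mset (count M Open4) Open4
     + replicate_mset (count M Spare) Spare + replicate_mset (count M Path3) Path3
     + replicate_mset (count M Tight) Tight"
proof (rule multiset_eqI)
  fix k show "count M k = count (replicate_mset (count M Open1) Open1 + replicate_mset (count M Open2) Open2
     + replicate_mset (count M Open3) Open3 + replicate_mset (count M Open4) Open4
     + replicate_mset (count M Spare) Spare + replicate_mset (count M Path3) Path3
     + replicate_mset (count M Tight) Tight) k"
    by (cases k) simp_all
qed

text \<open>\<open>a\<close>, \<open>b\<close>, \<open>c\<close>, \<open>d\<close>, \<open>p\<close>, \<open>t\<close> stand for the kinds \<open>Open1\<close> to \<open>Open4\<close>, \<open>Path3\<close>, \<open>Tight\<close>; the digit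
  is the top degree with which that many branches of the kind are used.\<close>

lemma choice_exists:
  assumes "count M Open1 = a0 + a1" "count M Open2 = b0 + b1 + b2"
    "count M Open3 = c0 + c2 + c3" "count M Open4 = d0 + d4"
    "count M Path3 = p0 + p2" "count M Tight = t0 + t2 + t3"
  obtains X where "choice M X"
    "top_degree X = a1 + b1 + b2 + c2 + c3 + d4 + p2 + t2 + t3"
    "child_degrees X = {s. s = 1 \<and> 0 < a1 + b1 \<or> s = 2 \<and> 0 < b2 + c2 + p2 + t2 \<or>
       s = 3 \<and> 0 < c3 + t3 \<or> s = 4 \<and> 0 < d4}"
    "credit X \<ge> int a1 - 2 * int a0 + 2 * int b2 - int b1 - 4 * int b0 + 4 * int c3 - 4 * int c2
       - 4 * int c0 + 8 * int d4 - 2 * int d0 - 2 * int t2 - int t3 + 2 * int (count M Spare)"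
proof -
  let ?X = "replicate_mset a0 (Open1, 0, -2) + replicate_mset a1 (Open1, 1, 1)
    + replicate_mset b0 (Open2, 0, -4) + replicate_mset b1 (Open2, 1, -1)
    + replicate_mset b2 (Open2, 2, 2) + replicate_mset c0 (Open3, 0, -4)
    + replicate_mset c2 (Open3, 2, -4) + replicate_mset c3 (Open3, 3, 4)
    + replicate_mset d0 (Open4, 0, -2) + replicate_mset d4 (Open4, 4, 8)
    + replicate_mset (count M Spare) (Spare, 0, 2)
    + replicate_mset p0 (Path3, 0, 0) + replicate_mset p2 (Path3, 2, 0)
    + replicate_mset t0 (Tight, 0, 0) + replicate_mset t2 (Tight, 2, -2)
    + replicate_mset t3 (Tight, 3, -1) :: (kind \<times> nat \<times> int) multiset"
  have "image_mset fst ?X = M"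
  proof (rule multiset_eqI)
    fix k show "count (image_mset fst ?X) k = count M k" by (cases k) (simp_all add: assms)
  qed
  moreover have "\<forall>x\<in>#?X. snd x \<in> opts (fst x)"
    by (simp only: set_mset_union ball_Un ball_replicate_mset) simp
  ultimately have "choice M ?X" by (simp add: choice_def)
  moreover have "top_degree ?X = a1 + b1 + b2 + c2 + c3 + d4 + p2 + t2 + t3"
    by (simp add: top_degree_simps)
  moreover have "child_degrees ?X = {s. s = 1 \<and> 0 < a1 + b1 \<or> s = 2 \<and> 0 < b2 + c2 + p2 + t2 \<or>
       s = 3 \<and> 0 < c3 + t3 \<or> s = 4 \<and> 0 < d4}"
    by (simp only: child_degrees_simps) auto
  moreover have "credit ?X = int a1 - 2 * int a0 + 2 * int b2 - int b1 - 4 * int b0 + 4 * int c3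
      - 4 * int c2 - 4 * int c0 + 8 * int d4 - 2 * int d0 - 2 * int t2 - int t3
      + 2 * int (count M Spare)"
    by (simp add: credit_simps)
  ultimately show thesis using that by simp
qed

text \<open>Child degrees lie between 1 and 4, so four conditions on the number of kept edges
  exclude every conflict.\<close>

lemma conflict_free_choice:
  assumes "count M Open1 = a0 + a1" "count M Open2 = b0 + b1 + b2"
    "count M Open3 = c0 + c2 + c3" "count M Open4 = d0 + d4"
    "count M Path3 = p0 + p2" "count M Tight = t0 + t2 + t3"
    and n: "a1 + b1 + b2 + c2 + c3 + d4 + p2 + t2 + t3 = 1 \<longrightarrow> a1 + b1 = 0"
    "a1 + b1 + b2 + c2 + c3 + d4 + p2 + t2 + t3 = 2 \<longrightarrow> b2 + c2 + p2 + t2 = 0"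
    "a1 + b1 + b2 + c2 + c3 + d4 + p2 + t2 + t3 = 3 \<longrightarrow> c3 + t3 = 0"
    "a1 + b1 + b2 + c2 + c3 + d4 + p2 + t2 + t3 = 4 \<longrightarrow> d4 = 0"
    and "c \<le> int a1 - 2 * int a0 + 2 * int b2 - int b1 - 4 * int b0 + 4 * int c3 - 4 * int c2
       - 4 * int c0 + 8 * int d4 - 2 * int d0 - 2 * int t2 - int t3 + 2 * int (count M Spare)"
  shows "\<exists>X. choice M X \<and> top_degree X \<notin> child_degrees X \<and> c \<le> credit X"
proof -
  obtain X where X: "choice M X"
    "top_degree X = a1 + b1 + b2 + c2 + c3 + d4 + p2 + t2 + t3"
    "child_degrees X = {s. s = 1 \<and> 0 < a1 + b1 \<or> s = 2 \<and> 0 < b2 + c2 + p2 + t2 \<or>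
       s = 3 \<and> 0 < c3 + t3 \<or> s = 4 \<and> 0 < d4}"
    "credit X \<ge> int a1 - 2 * int a0 + 2 * int b2 - int b1 - 4 * int b0 + 4 * int c3 - 4 * int c2
       - 4 * int c0 + 8 * int d4 - 2 * int d0 - 2 * int t2 - int t3 + 2 * int (count M Spare)"
    by (rule choice_exists[OF assms(1-6)])
  moreover have "top_degree X \<notin> child_degrees X"
    unfolding X(2,3) using n by (auto simp del: add_is_1)
  ultimately show ?thesis using assms(11) by (intro exI[of _ X]) simp
qed

text \<open>The edges above \<open>Spare\<close>, \<open>Path3\<close> and \<open>Tight\<close>
  children are deleted without loss. The factors 3, 3, 6, 8, 10 are the gains of an option over
  deletion; degree 2 of \<open>Open3\<close> gains nothing and only adjusts the top degree.\<close>

lemma branch_option_cut: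
  assumes "a1 \<le> count M Open1" "b1 + b2 \<le> count M Open2"
    "c2 + c3 \<le> count M Open3" "d4 \<le> count M Open4"
    and n: "a1 + b1 + b2 + c2 + c3 + d4 = 1 \<longrightarrow> a1 + b1 = 0"
    "a1 + b1 + b2 + c2 + c3 + d4 = 2 \<longrightarrow> b2 + c2 = 0"
    "a1 + b1 + b2 + c2 + c3 + d4 = 3 \<longrightarrow> c3 = 0" "a1 + b1 + b2 + c2 + c3 + d4 = 4 \<longrightarrow> d4 = 0"
    and c: "c + 2 + 2 * int (count M Open1) + 4 * int (count M Open2) + 4 * int (count M Open3)
      + 2 * int (count M Open4) \<le> 3 * int a1 + 3 * int b1 + 6 * int b2 + 8 * int c3 + 10 * int d4"
  shows "branch_option M (0, c)"
proof -
  obtain a0 b0 c0 d0 where count: "count M Open1 = a0 + a1" "count M Open2 = b0 + b1 + b2"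
    "count M Open3 = c0 + c2 + c3" "count M Open4 = d0 + d4"
    using that[of "count M Open1 - a1" "count M Open2 - (b1 + b2)" "count M Open3 - (c2 + c3)"
      "count M Open4 - d4"] assms(1-4) by linarith
  have "\<exists>X. choice M X \<and> top_degree X \<notin> child_degrees X \<and> c + 2 \<le> credit X"
    by (rule conflict_free_choice[OF count, of "count M Path3" 0 "count M Tight" 0 0])
      (use n c in \<open>simp_all add: count\<close>)
  then show ?thesis by (force simp: branch_option_def)
qed

text \<open>Here \<open>s\<close> includes the edge above, so conflicts are tested against
  \<open>s\<close>.\<close>

lemma branch_option_keep:
  assumes "a1 \<le> count M Open1" "b1 + b2 \<le> count M Open2"
    "c2 + c3 \<le> count M Open3" "d4 \<le> count M Open4"
    and n: "s = Suc (a1 + b1 + b2 + c2 + c3 + d4)"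
    "s = 1 \<longrightarrow> a1 + b1 = 0" "s = 2 \<longrightarrow> b2 + c2 = 0" "s = 3 \<longrightarrow> c3 = 0" "s = 4 \<longrightarrow> d4 = 0"
    and c: "c + 2 * int (count M Open1) + 4 * int (count M Open2) + 4 * int (count M Open3)
      + 2 * int (count M Open4) \<le> 1 + 3 * int a1 + 3 * int b1 + 6 * int b2 + 8 * int c3 + 10 * int d4"
  shows "branch_option M (s, c)"
proof -
  obtain a0 b0 c0 d0 where count: "count M Open1 = a0 + a1" "count M Open2 = b0 + b1 + b2"
    "count M Open3 = c0 + c2 + c3" "count M Open4 = d0 + d4"
    using that[of "count M Open1 - a1" "count M Open2 - (b1 + b2)" "count M Open3 - (c2 + c3)"
      "count M Open4 - d4"] assms(1-4) by linarith
  obtain X where X: "choice M X" "top_degree X = a1 + b1 + b2 + c2 + c3 + d4 + 0 + 0 + 0"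
    "child_degrees X = {s. s = 1 \<and> 0 < a1 + b1 \<or> s = 2 \<and> 0 < b2 + c2 + 0 + 0 \<or>
       s = 3 \<and> 0 < c3 + 0 \<or> s = 4 \<and> 0 < d4}"
    "credit X \<ge> int a1 - 2 * int a0 + 2 * int b2 - int b1 - 4 * int b0 + 4 * int c3 - 4 * int c2
       - 4 * int c0 + 8 * int d4 - 2 * int d0 - 2 * int 0 - int 0 + 2 * int (count M Spare)"
    by (rule choice_exists[OF count, of "count M Path3" 0 "count M Tight" 0 0]) simp_all
  have "s \<notin> child_degrees X" using n(2-) by (auto simp: X(3))
  moreover have "c \<le> credit X + 1" using X(4) c by (simp add: count)
  moreover have "s = Suc (top_degree X)" using X(2) n(1) by simp
  ultimately show ?thesis using X(1) by (auto simp: branch_option_def)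
qed

text \<open>Deleting the edge above costs 2, so the children must yield 4. The hypotheses exclude
  eleven small combinations, which \<open>behaves_cases\<close> treats.\<close>

lemma behaves_Spare:
  fixes M defines "n1 \<equiv> count M Open1" and "n2 \<equiv> count M Open2"
    and "n3 \<equiv> count M Open3" and "n4 \<equiv> count M Open4"
  assumes n: "n1 + n2 + n3 + n4 = 1 \<longrightarrow> n1 + n2 = 0"
    "n1 + n2 + n3 + n4 = 2 \<longrightarrow> n2 = 0 \<and> n1 \<noteq> 2 \<or> n4 \<noteq> 0"
    "n1 + n2 + n3 + n4 = 3 \<longrightarrow> n1 \<noteq> 3 \<and> (n3 \<noteq> 0 \<longrightarrow> n1 + n2 < 2)
       \<and> (n1 = 1 \<longrightarrow> n3 \<noteq> 0 \<longrightarrow> n2 = 0)"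
    "0 < n1 + n2 + n3 + n4"
  shows "behaves M Spare"
proof -
  note [simp] = n1_def[symmetric] n2_def[symmetric] n3_def[symmetric] n4_def[symmetric]
  \<comment> \<open>The arguments supplied below are \<open>a1\<close>, \<open>b1\<close>,
    \<open>b2\<close>, \<open>c2\<close>, \<open>c3\<close>, \<open>d4\<close>, in this
    order.\<close>
  note cut = branch_option_cut[of _ M]
  have "branch_option M (0, 2)"
  proof -
    consider (big) "n1 + n2 + n3 + n4 > 4" | (four) "n1 + n2 + n3 + n4 = 4"
      | (three) "n1 + n2 + n3 + n4 = 3" | (two) "n1 + n2 + n3 + n4 = 2"
      | (one) "n1 + n2 + n3 + n4 = 1" using n(4) by linarith
    then show ?thesis
    proof cases
      \<comment> \<open>With everything kept at its largest degree, the top degree exceeds 4 and no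
        conflict arises.\<close>
      case big
      then show ?thesis by (intro cut[of n1 0 n2 0 n3 n4]) auto
    next
      \<comment> \<open>If \<open>Open4\<close> occurs, deleting one branch gives top degree 3
        without a child of degree 3; with several \<open>Open3\<close>, one \<open>Open3\<close> and
        one \<open>Open4\<close> are kept instead.\<close>
      case four
      have "n4 = 0 \<or> n4 > 0 \<and> n3 = 0 \<and> n1 > 0 \<or> n4 > 0 \<and> n3 = 0 \<and> n1 = 0 \<and> n2 > 0
        \<or> n4 = 4 \<or> n4 > 0 \<and> n3 = 1 \<or> n4 > 0 \<and> n3 > 1"
        using four by presburger
      then consider "n4 = 0" | "n4 > 0" "n3 = 0" "n1 > 0" | "n4 > 0" "n3 = 0" "n1 = 0" "n2 > 0"
        | "n4 = 4" | "n4 > 0" "n3 = 1" | "n4 > 0" "n3 > 1"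
        by blast
      then show ?thesis
      proof cases
        case 1 then show ?thesis using four by (intro cut[of n1 0 n2 0 n3 n4]) auto
      next
        case 2 then show ?thesis using four by (intro cut[of "n1 - 1" 0 n2 0 n3 n4]) auto
      next
        case 3 then show ?thesis using four by (intro cut[of n1 0 "n2 - 1" 0 n3 n4]) auto
      next
        case 4 then show ?thesis using four by (intro cut[of 0 0 0 0 0 3]) auto
      next
        case 5 then show ?thesis using four by (intro cut[of n1 0 n2 0 0 n4]) auto
      next
        case 6 then show ?thesis using four by (intro cut[of 0 0 0 0 1 1]) auto
      qed
    next
      \<comment> \<open>If \<open>Open3\<close> occurs, deleting one branch leaves top degree 2 and
        only children of degrees 3 and 4.\<close>
      case three
      have "n3 = 0 \<or> n1 = 1 \<and> n2 = 0 \<or> n2 = 1 \<and> n1 = 0 \<or> n1 = 0 \<and> n2 = 0"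
        using three n(3) by presburger
      then consider "n3 = 0" | "n3 > 0" "n1 = 1" "n2 = 0" | "n3 > 0" "n2 = 1" "n1 = 0"
        | "n3 > 0" "n1 = 0" "n2 = 0" by blast
      then show ?thesis
      proof cases
        case 1 then show ?thesis using three n(3) by (intro cut[of n1 0 n2 0 n3 n4]) auto
      next
        case 2 then show ?thesis using three n(3) by (intro cut[of 0 0 0 0 n3 n4]) auto
      next
        case 3 then show ?thesis using three n(3) by (intro cut[of 0 0 0 0 n3 n4]) auto
      next
        case 4 then show ?thesis using three n(3) by (intro cut[of 0 0 0 0 "n3 - 1" n4]) auto
      qed
    next
      case two
      then show ?thesis using n(2) by (intro cut[of n1 n2 0 0 n3 n4]) auto
    next
      case one
      then show ?thesis using n(1) by (intro cut[of n1 0 n2 0 n3 n4]) auto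
    qed
  qed
  then show ?thesis by (simp add: behaves_def)
qed

text \<open>The counts are recorded for \<open>Open2\<close> and \<open>Open3\<close> because these
  alone have deletion credit below -2, which is too little at the root.\<close>

lemma behaves_cases:
  fixes M defines "n1 \<equiv> count M Open1" and "n2 \<equiv> count M Open2"
    and "n3 \<equiv> count M Open3" and "n4 \<equiv> count M Open4"
  shows "behaves M Open1 \<or> behaves M Open4 \<or> behaves M Spare \<or> behaves M Path3 \<or> behaves M Tight
    \<or> n1 = 1 \<and> n2 = 0 \<and> n3 = 0 \<and> n4 = 0 \<and> behaves M Open2
    \<or> n1 + n2 = 2 \<and> n2 \<noteq> 0 \<and> n3 = 0 \<and> n4 = 0 \<and> behaves M Open3"
proof -
  note [simp] = n1_def[symmetric] n2_def[symmetric] n3_def[symmetric] n4_def[symmetric]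
  note cut = branch_option_cut[of _ M] and keep = branch_option_keep[of _ M]
  note spare = behaves_Spare[of M, folded n1_def n2_def n3_def n4_def]
  have few: "(n1, n2, n3, n4) \<in> {(0,0,0,0), (1,0,0,0), (0,1,0,0), (2,0,0,0), (1,1,0,0),
    (0,2,0,0), (0,1,1,0), (3,0,0,0), (2,0,1,0), (1,1,1,0), (0,2,1,0)}" if "\<not> behaves M Spare"
  proof -
    have "n1 + n2 + n3 + n4 \<le> 3" using spare that by linarith
    moreover from this have "n1 \<in> {0,1,2,3}" "n2 \<in> {0,1,2,3}" "n3 \<in> {0,1,2,3}" "n4 \<in> {0,1,2,3}"
      by auto
    ultimately show ?thesis using spare that by (elim insertE emptyE) simp_all
  qed
  consider (spare) "behaves M Spare" | "n1 = 0" "n2 = 0" "n3 = 0" "n4 = 0"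
    | "n1 = 1" "n2 = 0" "n3 = 0" "n4 = 0" | "n1 = 0" "n2 = 1" "n3 = 0" "n4 = 0"
    | "n1 = 2" "n2 = 0" "n3 = 0" "n4 = 0" | "n1 = 1" "n2 = 1" "n3 = 0" "n4 = 0"
    | "n1 = 0" "n2 = 2" "n3 = 0" "n4 = 0" | "n1 = 0" "n2 = 1" "n3 = 1" "n4 = 0"
    | "n1 = 3" "n2 = 0" "n3 = 0" "n4 = 0" | "n1 = 2" "n2 = 0" "n3 = 1" "n4 = 0"
    | "n1 = 1" "n2 = 1" "n3 = 1" "n4 = 0" | "n1 = 0" "n2 = 2" "n3 = 1" "n4 = 0"
    using few by (cases "behaves M Spare") auto
  then show ?thesis
  proof cases
    case 2
    have "branch_option M (0, -2)" using 2 by (intro cut[of 0 0 0 0 0 0]) auto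
    moreover have "branch_option M (1, 1)" using 2 by (intro keep[of 0 0 0 0 0 0]) auto
    ultimately show ?thesis by (simp add: behaves_def)
  next
    case 3
    have "branch_option M (0, -4)" using 3 by (intro cut[of 0 0 0 0 0 0]) auto
    moreover have "branch_option M (1, -1)" using 3 by (intro keep[of 0 0 0 0 0 0]) auto
    moreover have "branch_option M (2, 2)" using 3 by (intro keep[of 1 0 0 0 0 0]) auto
    ultimately show ?thesis using 3 by (simp add: behaves_def)
  next
    case 4
    have "branch_option M (0, 0)" using 4 by (intro cut[of 0 0 1 0 0 0]) auto
    moreover have "branch_option M (2, 0)" using 4 by (intro keep[of 0 1 0 0 0 0]) auto
    ultimately show ?thesis by (simp add: behaves_def)
  next
    \<comment> \<open>\<open>Tight\<close> is a common lower bound for cases 5, 8, 9 and 10: its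
      credit 0 comes from case 5, -2 from case 9, -1 from cases 8 and 10.\<close>
    case 5
    have "branch_option M (0, 0)" using 5 by (intro cut[of 2 0 0 0 0 0]) auto
    moreover have "branch_option M (2, -2)" using 5 by (intro keep[of 1 0 0 0 0 0]) auto
    moreover have "branch_option M (3, -1)" using 5 by (intro keep[of 2 0 0 0 0 0]) auto
    ultimately show ?thesis by (simp add: behaves_def)
  next
    \<comment> \<open>\<open>Open3\<close> covers cases 6 and 7: the credit 4 comes from the former,
      both -4 from the latter.\<close>
    case 6
    have "branch_option M (0, -4)" using 6 by (intro cut[of 0 0 1 0 0 0]) auto
    moreover have "branch_option M (2, -4)" using 6 by (intro keep[of 1 0 0 0 0 0]) auto
    moreover have "branch_option M (3, 4)" using 6 by (intro keep[of 1 0 1 0 0 0]) auto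
    ultimately show ?thesis using 6 by (simp add: behaves_def)
  next
    case 7
    have "branch_option M (0, -4)" using 7 by (intro cut[of 0 0 1 0 0 0]) auto
    moreover have "branch_option M (2, -4)" using 7 by (intro keep[of 0 1 0 0 0 0]) auto
    moreover have "branch_option M (3, 4)" using 7 by (intro keep[of 0 0 2 0 0 0]) auto
    ultimately show ?thesis using 7 by (simp add: behaves_def)
  next
    case 8
    have "branch_option M (0, 0)" using 8 by (intro cut[of 0 1 0 0 1 0]) auto
    moreover have "branch_option M (2, -2)" using 8 by (intro keep[of 0 0 0 0 1 0]) auto
    moreover have "branch_option M (3, -1)" using 8 by (intro keep[of 0 0 1 1 0 0]) auto
    ultimately show ?thesis by (simp add: behaves_def)
  next
    case 9
    have "branch_option M (0, 0)" using 9 by (intro cut[of 3 0 0 0 0 0]) auto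
    moreover have "branch_option M (2, -2)" using 9 by (intro keep[of 1 0 0 0 0 0]) auto
    moreover have "branch_option M (3, -1)" using 9 by (intro keep[of 2 0 0 0 0 0]) auto
    ultimately show ?thesis by (simp add: behaves_def)
  next
    case 10
    have "branch_option M (0, 0)" using 10 by (intro cut[of 1 0 0 0 1 0]) auto
    moreover have "branch_option M (2, -2)" using 10 by (intro keep[of 0 0 0 0 1 0]) auto
    moreover have "branch_option M (3, -1)" using 10 by (intro keep[of 2 0 0 0 0 0]) auto
    ultimately show ?thesis by (simp add: behaves_def)
  next
    \<comment> \<open>\<open>Open4\<close> covers cases 11 and 12: 8 comes from the former, -2 from
      the latter, where \<open>Open3\<close> takes degree 2 because the top degree is 3.\<close>
    case 11
    have "branch_option M (0, -2)" using 11 by (intro cut[of 0 1 0 0 1 0]) auto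
    moreover have "branch_option M (4, 8)" using 11 by (intro keep[of 1 0 1 0 1 0]) auto
    ultimately show ?thesis by (simp add: behaves_def)
  next
    case 12
    have "branch_option M (0, -2)" using 12 by (intro cut[of 0 0 2 1 0 0]) auto
    moreover have "branch_option M (4, 8)" using 12 by (intro keep[of 0 0 2 0 1 0]) auto
    ultimately show ?thesis by (simp add: behaves_def)
  next
    case spare
    then show ?thesis by simp
  qed
qed

section \<open>The choice at the root\<close>

lemma size_kinds:
  "size M = count M Open1 + count M Open2 + count M Open3 + count M Open4
     + count M Spare + count M Path3 + count M Tight"
  using arg_cong[OF multiset_kind_eq[of M], of size] by simp

text \<open>The root is treated as if an edge above it were deleted: that edge costs 2, so an option
  \<open>(0, c)\<close> with \<open>c \<ge> -2\<close> already gives credit at least 0. Only the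
  child counts of \<open>Open2\<close> and \<open>Open3\<close> remain.\<close>

lemma root_choice:
  assumes "size M \<ge> 3"
  shows "\<exists>X. choice M X \<and> top_degree X \<notin> child_degrees X \<and> 0 \<le> credit X"
proof -
  define n1 n2 n3 n4 p t u where n: "n1 = count M Open1" "n2 = count M Open2" "n3 = count M Open3"
    "n4 = count M Open4" "p = count M Path3" "t = count M Tight" "u = count M Spare"
  note [simp] = n[symmetric]
  have "\<exists>X. choice M X \<and> top_degree X \<notin> child_degrees X \<and> 0 \<le> credit X"
    if "branch_option M (0, c)" "c \<ge> -2" for c
    using that by (fastforce simp: branch_option_def)
  moreover have size: "n1 + n2 + n3 + n4 + u + p + t \<ge> 3"
    using assms by (simp add: size_kinds)
  ultimately consider (solved) ?thesis | (leaf) "n1 = 1" "n2 = 0" "n3 = 0" "n4 = 0"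
    | (path) "n1 + n2 = 2" "n2 \<noteq> 0" "n3 = 0" "n4 = 0"
    using behaves_cases[of M] by (force simp: behaves_def)
  then show ?thesis
  proof cases
    \<comment> \<open>A \<open>Spare\<close> pays for deleting the \<open>Open1\<close> edge;
      otherwise \<open>Open1\<close> is kept with a \<open>Tight\<close> at degree 3 (top degree 2)
      or two \<open>Path3\<close> at degree 2 (top degree 3).\<close>
    case leaf
    consider "u > 0" | "t > 0" | "p > 1" using size leaf by linarith
    then show ?thesis
    proof cases
      case 1
      then show ?thesis
        using leaf by (intro conflict_free_choice[of M 1 0 0 0 0 0 0 0 0 0 p 0 t 0 0]) auto
    next
      case 2
      then show ?thesis
        using leaf by (intro conflict_free_choice[of M 0 1 0 0 0 0 0 0 0 0 p 0 "t - 1" 0 1]) auto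
    next
      case 3
      then show ?thesis
        using leaf by (intro conflict_free_choice[of M 0 1 0 0 0 0 0 0 0 0 "p - 2" 2 t 0 0]) auto
    qed
  next
    \<comment> \<open>Either one \<open>Open2\<close> is kept alone, with the other branch deleted,
      or two \<open>Open2\<close> are kept with a \<open>Tight\<close> or \<open>Path3\<close>, all
      at degree 2 below top degree 3.\<close>
    case path
    consider "n1 = 1" "n2 = 1" | "n2 = 2" "n1 = 0" "u > 0" | "n2 = 2" "n1 = 0" "t > 0"
      | "n2 = 2" "n1 = 0" "p > 0"
      using size path by linarith
    then show ?thesis
    proof cases
      case 1
      then show ?thesis
        using path by (intro conflict_free_choice[of M 1 0 0 0 1 0 0 0 0 0 p 0 t 0 0]) auto
    next
      case 2
      then show ?thesis
        using path by (intro conflict_free_choice[of M 0 0 1 0 1 0 0 0 0 0 p 0 t 0 0]) auto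
    next
      case 3
      then show ?thesis
        using path by (intro conflict_free_choice[of M 0 0 0 0 2 0 0 0 0 0 p 0 "t - 1" 1 0]) auto
    next
      case 4
      then show ?thesis
        using path by (intro conflict_free_choice[of M 0 0 0 0 2 0 0 0 0 0 "p - 1" 1 t 0 0]) auto
    qed
  qed
qed

section \<open>Assembling a solution\<close>

text \<open>Every combination of the promised options has to be realizable, since the choice among
  them is made later.\<close>

definition solves :: "'a \<Rightarrow> 'a set set \<Rightarrow> kind multiset \<Rightarrow> bool" where
  "solves r E M \<longleftrightarrow>
     (\<forall>X. choice M X \<longrightarrow> partial_sol r E (top_degree X) (child_degrees X) (credit X))"

lemma partial_sol_mono: "partial_sol r E d A c \<Longrightarrow> c' \<le> c \<Longrightarrow> partial_sol r E d A c'"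
  unfolding partial_sol_def
  by (elim exE conjE, rule exI, intro conjI) (assumption | erule order_trans)+

text \<open>The option picked for the new branch is turned by \<open>behaves\<close> into a choice
  for the children of \<open>x\<close>, followed by cutting or keeping the edge.\<close>

lemma solves_graft:
  assumes "rtree r V E" "rtree x W D" "V \<inter> W = {}"
    and "solves r E M" "solves x D N" "behaves N k"
  shows "solves r (insert {r, x} (E \<union> D)) (add_mset k M)"
  unfolding solves_def
proof (intro allI impI)
  fix X assume "choice (add_mset k M) X"
  then obtain s c Y where Y: "(s, c) \<in> opts k" "choice M Y"
    and X: "top_degree X = top_degree Y + (if s = 0 then 0 else 1)"
    "child_degrees X = (if s = 0 then {} else {s}) \<union> child_degrees Y" "credit X = credit Y + c"
    by (rule choice_add_mset)
  have opt: "branch_option N (s, c)" using assms(6) Y(1) by (auto simp: behaves_def)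
  have solY: "partial_sol r E (top_degree Y) (child_degrees Y) (credit Y)"
    using assms(4) Y(2) by (simp add: solves_def)
  show "partial_sol r (insert {r, x} (E \<union> D)) (top_degree X) (child_degrees X) (credit X)"
  proof (cases "s = 0")
    case True
    then obtain Z where Z: "choice N Z" "top_degree Z \<notin> child_degrees Z" "c \<le> credit Z - 2"
      using opt by (auto simp: branch_option_def)
    then have "partial_sol x D (top_degree Z) (child_degrees Z) (credit Z)"
      using assms(5) by (simp add: solves_def)
    from partial_sol_cut[OF assms(1-3) solY this Z(2)]
    have "partial_sol r (insert {r, x} (E \<union> D)) (top_degree X) (child_degrees X)
      (credit Y + (credit Z - 2))"
      using True X by simp
    then show ?thesis by (rule partial_sol_mono) (use X Z(3) in simp)
  next
    case False
    then obtain Z where Z: "choice N Z" "s = Suc (top_degree Z)" "s \<notin> child_degrees Z"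
      "c \<le> credit Z + 1"
      using opt by (auto simp: branch_option_def)
    then have "partial_sol x D (top_degree Z) (child_degrees Z) (credit Z)"
      using assms(5) by (simp add: solves_def)
    from partial_sol_keep[OF assms(1-3) solY this Z(3)[unfolded Z(2)]]
    have "partial_sol r (insert {r, x} (E \<union> D)) (top_degree X) (child_degrees X)
      (credit Y + (credit Z + 1))"
      using False X Z(2) by simp
    then show ?thesis by (rule partial_sol_mono) (use X Z(4) in simp)
  qed
qed

lemma rtree_solves:
  "rtree r V E \<Longrightarrow> \<exists>M. size M = degree E r \<and> solves r E M"
proof (induction rule: rtree.induct)
  case (single r)
  have "solves r {} {#}"
    by (auto simp: solves_def choice_def partial_sol_def top_degree_def child_degrees_def
        credit_def degree_def adj_def)
  then show ?case by (intro exI[of _ "{#}"]) (simp add: degree_def)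
next
  case (graft r V E x W D)
  then obtain M N where M: "size M = degree E r" "solves r E M" and N: "solves x D N" by blast
  obtain k where "behaves N k" using behaves_cases[of N] by blast
  from solves_graft[OF graft(1-3) M(2) N this] show ?case
    using rtree_graft_degree(1)[OF graft(1-3)] M(1) by (intro exI[of _ "add_mset k M"]) simp
qed

theorem theorem8:
  fixes V :: "'a set" and E :: "'a set set"
  assumes "tree V E"
  shows "is_path_graph V E \<or> 3 * Ie E \<le> card E"
proof (cases "\<forall>v. degree E v \<le> 2")
  case True
  obtain r where "r \<in> V" using assms by (auto simp: tree_def)
  then show ?thesis using rtree_is_path_graph[OF tree_rtree[OF assms] True] by blast
next
  case False
  then obtain r where "\<not> degree E r \<le> 2" by blast
  then have r: "degree E r \<ge> 3" by simp
  then have "{e \<in> E. r \<in> e} \<noteq> {}" unfolding degree_def by force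
  then have "r \<in> V" using assms by (auto simp: tree_def simple_graph_def)
  then obtain M where M: "size M = degree E r" "solves r E M"
    using rtree_solves[OF tree_rtree[OF assms]] by blast
  obtain X where X: "choice M X" "top_degree X \<notin> child_degrees X" "0 \<le> credit X"
    using root_choice[of M] M(1) r by auto
  then have "partial_sol r E (top_degree X) (child_degrees X) (credit X)"
    using M(2) by (simp add: solves_def)
  then obtain F where F: "F \<subseteq> E" "degree F r = top_degree X"
    "\<forall>u. adj F r u \<longrightarrow> degree F u \<in> child_degrees X"
    "\<forall>u v. u \<noteq> r \<longrightarrow> v \<noteq> r \<longrightarrow> adj F u v \<longrightarrow> degree F u \<noteq> degree F v"
    "credit X \<le> int (card E) - 3 * int (card (E - F))"
    unfolding partial_sol_def by blast
  \<comment> \<open>Conflicts at the root, tolerated by \<open>partial_sol\<close>, are excluded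
    because its degree is not among the child degrees.\<close>
  have "degree F u \<noteq> degree F v" if "adj F u v" for u v
    using F(2-4) X(2) that adj_sym[OF that] by metis
  then have "locally_irregular F" by (simp add: locally_irregular_def)
  moreover have "E - (E - F) = F" using F(1) by blast
  ultimately have "edge_irregulator E (E - F)" by (simp add: edge_irregulator_def)
  then have "Ie E \<le> card (E - F)" unfolding Ie_def by (intro Least_le) blast
  then show ?thesis using F(5) X(3) by linarith
qed

end
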